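(* Let $f:Q\to\mathbb{R}$ be a convex continuous function, let $x^*\in Q$ be an optimal solution of $\min_{x\in Q} f(x)$, and let $R>0$ be such that $V_\psi(x^*,x)\le R$ for all $x\in Q$. Fix $a\in[0,1]$ and an integer $N\ge 1$. Let $x^1\in Q$ and let $x^2,\ldots,x^{N+1}$ be generated by the mirror descent method $$x^{k+1}=\arg\min_{x\in Q}\left\{\langle x,\nabla f(x^k)\rangle+\frac{1}{\gamma_k}V_\psi(x,x^k)\right\},\qquad \nabla f(x^k)\in\partial f(x^k),\qquad k=1,\ldots,N,$$ with the positive non-increasing step sizes $$\gamma_k=\frac{\sqrt{2\sigma R}}{G_k\,k^{a/2}},\qquad k=1,\ldots,N,$$ where $$G_k=\max\left\{G_{k-1},\ \|\nabla f(x^k)\|_*\,k^{\frac{1-a}{2}}\right\},\qquad G_0:=-\infty.$$ Then $$f\left(\frac{1}{N}\sum_{k=1}^N x^k\right)-f(x^* )\le 3\sqrt{\frac{R}{2\sigma}}\cdot\frac{1}{\sqrt{N}}\cdot\max_{k=1,\ldots,N}\|\nabla f(x^k)\|_*.$$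
   Context: $(\mathbf{E},\|\cdot\|)$ is a normed finite-dimensional real vector space with an arbitrary norm, $\mathbf{E}^*$ is its conjugate (dual) space with norm $\|y\|_*=\max\{\langle y,x\rangle:\ x\in\mathbf{E},\ \|x\|\le 1\}$, where $\langle y,x\rangle$ is the value of $y\in\mathbf{E}^*$ at $x\in\mathbf{E}$. $Q\subset\mathbf{E}$ is a compact convex set. $\psi:Q\to\mathbb{R}$ is a proper closed differentiable function that is $\sigma$-strongly convex with respect to $\|\cdot\|$, with $\sigma>0$ (the prox-function). Its Bregman divergence is $V_\psi(x,y)=\psi(x)-\psi(y)-\langle\nabla\psi(y),x-y\rangle$ for $x,y\in Q$; it satisfies $V_\psi(x,y)\ge\frac{\sigma}{2}\|x-y\|^2$. $\partial f(x)$ denotes the subdifferential of $f$ at $x$, i.e. the set of $g\in\mathbf{E}^*$ with $f(y)\ge f(x)+\langle g,y-x\rangle$ for all $y\in Q$, and $\nabla f(x)$ denotes a chosen element of $\partial f(x)$; the method presupposes that a subgradient is available at each iterate $x^1,\ldots,x^N$. No Lipschitz continuity of $f$ and no a priori bound on the subgradients is assumed. Positivity (well-definedness) of the step sizes means $G_k>0$ for all $k$, i.e. $\nabla f(x^1)\ne 0$. *)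

theory Defs
  imports "HOL-Analysis.Analysis"
begin

text \<open>
  The dual space is the type \<open>'a \<Rightarrow>\<^sub>L real\<close> of bounded linear functionals with its operator
  norm. When \<open>'a\<close> is finite-dimensional, these are all the linear functionals. The norm
  agrees with the supremum over the closed unit ball:
\<close>

lemma norm_blinfun_eq_SUP_cball:
  fixes g :: "'a::real_normed_vector \<Rightarrow>\<^sub>L real"
  shows "norm g = (SUP x\<in>cball 0 1. blinfun_apply g x)"
proof (rule antisym)
  have le: "blinfun_apply g x \<le> norm g" if "x \<in> cball 0 1" for x
  proof -
    have "blinfun_apply g x \<le> norm g * norm x"
      using norm_blinfun[of g x] by simp
    also have "\<dots> \<le> norm g * 1"
      using that by (intro mult_left_mono) auto
    finally show ?thesis by simp
  qed
  have bdd: "bdd_above (blinfun_apply g ` cball 0 1)"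
    using le by (intro bdd_aboveI2)
  show "(SUP x\<in>cball 0 1. blinfun_apply g x) \<le> norm g"
    using le by (intro cSUP_least) auto
  let ?s = "SUP x\<in>cball 0 1. blinfun_apply g x"
  have up: "blinfun_apply g x \<le> ?s" if "norm x \<le> 1" for x
    using that bdd by (intro cSUP_upper) auto
  show "norm g \<le> ?s"
  proof (rule norm_blinfun_bound)
    show "0 \<le> ?s" using up[of 0] by simp
    show "norm (blinfun_apply g x) \<le> ?s * norm x" for x
    proof (cases "x = 0")
      case False
      then have "norm (x /\<^sub>R norm x) \<le> 1" "norm (- (x /\<^sub>R norm x)) \<le> 1" by auto
      from up[OF this(1)] up[OF this(2)]
      have "\<bar>blinfun_apply g x\<bar> / norm x \<le> ?s"
        by (auto simp: blinfun.scaleR_right blinfun.minus_right divide_inverse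
            mult.commute abs_if)
      with False show ?thesis by (simp add: field_simps)
    qed auto
  qed
qed

definition subdifferential ::
  "'a::real_normed_vector set \<Rightarrow> ('a \<Rightarrow> real) \<Rightarrow> 'a \<Rightarrow> ('a \<Rightarrow>\<^sub>L real) set" where
  "subdifferential Q f x = {g. \<forall>y\<in>Q. f y \<ge> f x + blinfun_apply g (y - x)}"

definition strongly_convex_on ::
  "'a::real_normed_vector set \<Rightarrow> real \<Rightarrow> ('a \<Rightarrow> real) \<Rightarrow> bool" where
  "strongly_convex_on Q \<sigma> \<psi> \<longleftrightarrow> convex Q \<and>
    (\<forall>x\<in>Q. \<forall>y\<in>Q. \<forall>t\<in>{0..1}.
       \<psi> (t *\<^sub>R x + (1 - t) *\<^sub>R y)
         \<le> t * \<psi> x + (1 - t) * \<psi> y - \<sigma> / 2 * t * (1 - t) * (norm (x - y))\<^sup>2)"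

text \<open>
  The gradient of \<open>\<psi>\<close> is its Frechet derivative relative to \<open>Q\<close>, since \<open>\<psi>\<close> is only given
  on \<open>Q\<close>. If \<open>Q\<close> has empty interior, this derivative need not be unique, but for convex \<open>Q\<close>
  its value on the differences \<open>x - y\<close> with \<open>x, y \<in> Q\<close> is, so the divergence does not depend
  on the choice made by \<^const>\<open>frechet_derivative\<close>; see \<open>bregman_eq\<close> below.
\<close>

definition bregman ::
  "'a::real_normed_vector set \<Rightarrow> ('a \<Rightarrow> real) \<Rightarrow> 'a \<Rightarrow> 'a \<Rightarrow> real" where
  "bregman Q \<psi> x y = \<psi> x - \<psi> y - frechet_derivative \<psi> (at y within Q) (x - y)"

lemma bregman_eq:
  fixes \<psi> :: "'a::real_normed_vector \<Rightarrow> real"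
  assumes Q: "convex Q" "x \<in> Q" "y \<in> Q"
    and D: "(\<psi> has_derivative D) (at y within Q)"
  shows "bregman Q \<psi> x y = \<psi> x - \<psi> y - D (x - y)"
proof -
  define c where "c t = y + t *\<^sub>R (x - y)" for t :: real
  have c: "(c has_derivative (\<lambda>t. t *\<^sub>R (x - y))) (at 0 within {0..1})"
    unfolding c_def by (auto intro!: derivative_eq_intros)
  have sub: "c ` {0..1} \<subseteq> Q"
  proof (rule image_subsetI)
    fix t :: real assume "t \<in> {0..1}"
    moreover have "c t = (1 - t) *\<^sub>R y + t *\<^sub>R x"
      by (simp add: c_def algebra_simps)
    ultimately show "c t \<in> Q"
      using convexD_alt[OF Q(1,3,2), of t] by simp
  qed
  have vec: "(\<psi> \<circ> c has_vector_derivative F (x - y)) (at 0 within {0..1})"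
    if F: "(\<psi> has_derivative F) (at y within Q)" for F
  proof -
    have "(\<psi> has_derivative F) (at (c 0) within c ` {0..1})"
      using has_derivative_subset[OF F sub] by (simp add: c_def)
    from diff_chain_within[OF c this]
    have "(\<psi> \<circ> c has_derivative (\<lambda>t. F (t *\<^sub>R (x - y)))) (at 0 within {0..1})"
      by (simp add: o_def)
    then show ?thesis
      using linear_cmul[OF has_derivative_linear[OF F]]
      by (simp add: has_vector_derivative_def)
  qed
  have "(\<psi> has_derivative frechet_derivative \<psi> (at y within Q)) (at y within Q)"
    using D frechet_derivative_works differentiable_def by blast
  from vec[OF this] vec[OF D]
  have "frechet_derivative \<psi> (at y within Q) (x - y) = D (x - y)"
    using vector_derivative_unique_within_closed_interval[of 0 1 0] by auto
  then show ?thesis by (simp add: bregman_def)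
qed

text \<open>
  The sequence \<open>g\<close> lists the subgradients at the iterates, starting at index 1. The running
  maximum is extended-real valued in order to start from \<open>-\<infinity>\<close>; it is a real number from
  index 1 on.
\<close>

primrec run_max :: "real \<Rightarrow> (nat \<Rightarrow> 'a::real_normed_vector \<Rightarrow>\<^sub>L real) \<Rightarrow> nat \<Rightarrow> ereal" where
  "run_max a g 0 = -\<infinity>"
| "run_max a g (Suc k) =
     max (run_max a g k) (ereal (norm (g (Suc k)) * real (Suc k) powr ((1 - a) / 2)))"

definition step_size ::
  "real \<Rightarrow> real \<Rightarrow> real \<Rightarrow> (nat \<Rightarrow> 'a::real_normed_vector \<Rightarrow>\<^sub>L real) \<Rightarrow> nat \<Rightarrow> real" where
  "step_size \<sigma> R a g k =
     sqrt (2 * \<sigma> * R) / (real_of_ereal (run_max a g k) * real k powr (a / 2))"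

definition mirror_descent ::
  "'a::real_normed_vector set \<Rightarrow> ('a \<Rightarrow> real) \<Rightarrow> ('a \<Rightarrow> real)
    \<Rightarrow> (nat \<Rightarrow> real) \<Rightarrow> nat \<Rightarrow> (nat \<Rightarrow> 'a \<Rightarrow>\<^sub>L real) \<Rightarrow> (nat \<Rightarrow> 'a) \<Rightarrow> bool" where
  "mirror_descent Q \<psi> f \<gamma> N g x \<longleftrightarrow> x 1 \<in> Q \<and>
    (\<forall>k\<in>{1..N}. g k \<in> subdifferential Q f (x k) \<and>
       is_arg_min (\<lambda>u. blinfun_apply (g k) u + 1 / \<gamma> k * bregman Q \<psi> u (x k))
         (\<lambda>u. u \<in> Q) (x (Suc k)))"

end

theory Submission
  imports Defs
begin

text \<open>
  Comparing \<open>x\<^bsup>k+1\<^esup>\<close> with \<open>x\<^sup>*\<close> in the first-order optimality condition of the prox step, and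
  absorbing \<open>\<gamma>\<^sub>k \<langle>\<nabla>f(x\<^sup>k), x\<^sup>k - x\<^bsup>k+1\<^esup>\<rangle>\<close> into \<open>V\<^sub>\<psi>(x\<^bsup>k+1\<^esup>, x\<^sup>k) \<ge> \<sigma>/2 \<parallel>x\<^bsup>k+1\<^esup> - x\<^sup>k\<parallel>\<^sup>2\<close>, gives
  \<open>f(x\<^sup>k) - f(x\<^sup>*) \<le> (V\<^sub>\<psi>(x\<^sup>*, x\<^sup>k) - V\<^sub>\<psi>(x\<^sup>*, x\<^bsup>k+1\<^esup>)) / \<gamma>\<^sub>k + \<gamma>\<^sub>k \<parallel>\<nabla>f(x\<^sup>k)\<parallel>\<^sup>2 / (2\<sigma>)\<close>.
  Summing over \<open>k\<close>, the first terms are at most \<open>R / \<gamma>\<^sub>N\<close> by Abel summation. With \<open>M\<close> the largest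
  subgradient norm, \<open>G\<^sub>k \<le> M k\<^bsup>(1-a)/2\<^esup>\<close> bounds \<open>R / \<gamma>\<^sub>N\<close> by \<open>M \<surd>(R/(2\<sigma>)) \<surd>N\<close>, and
  \<open>\<parallel>\<nabla>f(x\<^sup>k)\<parallel> k\<^bsup>(1-a)/2\<^esup> \<le> G\<^sub>k\<close> bounds the second sum by \<open>M \<surd>(R/(2\<sigma>)) \<Sum> 1/\<surd>k \<le> 2 M \<surd>(R/(2\<sigma>)) \<surd>N\<close>.
  The exponent \<open>a\<close> cancels in both.
\<close>

section \<open>One-sided derivatives along segments and the Bregman divergence\<close>

text \<open>The difference quotient of \<open>h\<close> from \<open>y\<close> towards
  \<open>u\<close> is at least \<open>c t\<close>, and its right limit is \<open>D (u - y)\<close>.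
  A varying \<open>c\<close> leaves room for the factor \<open>1 - t\<close> of strong
  convexity.\<close>

lemma has_derivative_ge_along_segment:
  fixes h :: "'a::real_normed_vector \<Rightarrow> real"
  assumes Q: "convex Q" "y \<in> Q" "u \<in> Q"
    and D: "(h has_derivative D) (at y within Q)"
    and le: "\<And>t. 0 < t \<Longrightarrow> t < 1 \<Longrightarrow> t * c t \<le> h (y + t *\<^sub>R (u - y)) - h y"
    and lim: "(c \<longlongrightarrow> l) (at_right 0)"
  shows "l \<le> D (u - y)"
proof -
  define p where "p t = y + t *\<^sub>R (u - y)" for t :: real
  have p: "(p has_derivative (\<lambda>t. t *\<^sub>R (u - y))) (at 0 within {0..1})"
    unfolding p_def by (auto intro!: derivative_eq_intros)
  have sub: "p ` {0..1} \<subseteq> Q"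
  proof (rule image_subsetI)
    fix t :: real assume "t \<in> {0..1}"
    moreover have "p t = (1 - t) *\<^sub>R y + t *\<^sub>R u"
      by (simp add: p_def algebra_simps)
    ultimately show "p t \<in> Q"
      using convexD_alt[OF Q, of t] by simp
  qed
  have "(h has_derivative D) (at (p 0) within p ` {0..1})"
    using has_derivative_subset[OF D sub] by (simp add: p_def)
  from diff_chain_within[OF p this]
  have "((\<lambda>t. h (p t)) has_derivative (\<lambda>t. D (t *\<^sub>R (u - y)))) (at 0 within {0..1})"
    by (simp add: o_def)
  then have "((\<lambda>t. h (p t)) has_real_derivative D (u - y)) (at 0 within {0..1})"
    using linear_cmul[OF has_derivative_linear[OF D]]
    by (simp add: has_real_derivative_iff_has_vector_derivative has_vector_derivative_def)
  then have "((\<lambda>t. (h (p t) - h y) / t) \<longlongrightarrow> D (u - y)) (at_right 0)"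
    by (simp add: has_field_derivative_iff at_within_Icc_at_right p_def)
  moreover have "\<forall>\<^sub>F t in at_right 0. c t \<le> (h (p t) - h y) / t"
    using eventually_at_right_real[of 0 1, OF zero_less_one]
    by eventually_elim (use le in \<open>auto simp: p_def field_simps\<close>)
  ultimately show ?thesis
    using lim tendsto_le trivial_limit_at_right_real by blast
qed

text \<open>Strong convexity bounds the increment of \<open>\<psi>\<close> along the segment from
  above; dividing by \<open>t\<close> and letting \<open>t\<close> tend to 0 keeps the full
  quadratic term.\<close>

lemma bregman_ge_norm:
  fixes \<psi> :: "'a::real_normed_vector \<Rightarrow> real"
  assumes sc: "strongly_convex_on Q \<sigma> \<psi>" and diff: "\<psi> differentiable_on Q"
    and uy: "u \<in> Q" "y \<in> Q"
  shows "\<sigma> / 2 * (norm (u - y))\<^sup>2 \<le> bregman Q \<psi> u y"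
proof -
  let ?D = "frechet_derivative \<psi> (at y within Q)"
  let ?c = "\<lambda>t. - (\<psi> u - \<psi> y) + \<sigma> / 2 * (1 - t) * (norm (u - y))\<^sup>2"
  have Q: "convex Q" using sc by (simp add: strongly_convex_on_def)
  have D: "(\<psi> has_derivative ?D) (at y within Q)"
    using diff uy by (simp add: differentiable_on_def frechet_derivative_works)
  \<comment> \<open>The segment lemma yields lower bounds on derivatives, so it is applied to
    \<open>- \<psi>\<close>.\<close>
  have "- (\<psi> u - \<psi> y) + \<sigma> / 2 * (norm (u - y))\<^sup>2 \<le> - ?D (u - y)"
  proof (rule has_derivative_ge_along_segment[OF Q uy(2,1) has_derivative_minus[OF D]])
    show "t * ?c t \<le> - \<psi> (y + t *\<^sub>R (u - y)) - - \<psi> y" if "0 < t" "t < 1" for t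
    proof -
      have "y + t *\<^sub>R (u - y) = t *\<^sub>R u + (1 - t) *\<^sub>R y"
        by (simp add: algebra_simps)
      moreover have "\<psi> (t *\<^sub>R u + (1 - t) *\<^sub>R y)
          \<le> t * \<psi> u + (1 - t) * \<psi> y - \<sigma> / 2 * t * (1 - t) * (norm (u - y))\<^sup>2"
        using sc uy that by (simp add: strongly_convex_on_def)
      ultimately show ?thesis by (simp add: algebra_simps)
    qed
    show "(?c \<longlongrightarrow> - (\<psi> u - \<psi> y) + \<sigma> / 2 * (norm (u - y))\<^sup>2) (at_right 0)"
      by (auto intro!: tendsto_eq_intros)
  qed
  then show ?thesis by (simp add: bregman_def)
qed

section \<open>A single mirror step\<close>

text \<open>At the minimizer \<open>z\<close> the derivative in direction \<open>u - z\<close> is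
  nonnegative. By the three-point identity, the right side is the difference of the derivatives of
  \<open>\<psi>\<close> at \<open>z\<close> and at \<open>y\<close>, applied to
  \<open>u - z\<close>.\<close>

lemma mirror_step_optimality:
  fixes \<psi> :: "'a::real_normed_vector \<Rightarrow> real" and g :: "'a \<Rightarrow>\<^sub>L real"
  assumes Q: "convex Q" and diff: "\<psi> differentiable_on Q"
    and yu: "y \<in> Q" "u \<in> Q" and \<gamma>: "\<gamma> > 0"
    and min: "is_arg_min (\<lambda>u. g u + 1 / \<gamma> * bregman Q \<psi> u y) (\<lambda>u. u \<in> Q) z"
  shows "\<gamma> * g (z - u) \<le> bregman Q \<psi> u y - bregman Q \<psi> u z - bregman Q \<psi> z y"
proof -
  let ?D = "\<lambda>y. frechet_derivative \<psi> (at y within Q)"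
  let ?h = "\<lambda>u. g u + 1 / \<gamma> * bregman Q \<psi> u y"
  have D: "(\<psi> has_derivative ?D y) (at y within Q)" if "y \<in> Q" for y
    using diff that by (simp add: differentiable_on_def frechet_derivative_works)
  have lin: "linear (?D y)" if "y \<in> Q" for y
    using D[OF that] by (rule has_derivative_linear)
  have le: "?h z \<le> ?h v" if "v \<in> Q" for v
    using min that by (auto simp: is_arg_min_linorder)
  have z: "z \<in> Q" using min by (simp add: is_arg_min_def)
  have Dy: "((\<lambda>v. ?D y (v - y)) has_derivative (\<lambda>v. ?D y (v - 0))) (at z within Q)"
    by (intro bounded_linear.has_derivative[OF has_derivative_bounded_linear[OF D[OF yu(1)]]]
        has_derivative_diff has_derivative_ident has_derivative_const)
  have h: "(?h has_derivative (\<lambda>v. g v + 1 / \<gamma> * (?D z v - 0 - ?D y (v - 0)))) (at z within Q)"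
    unfolding bregman_def
    by (intro has_derivative_add has_derivative_mult_right has_derivative_diff has_derivative_const
        D[OF z] Dy bounded_linear_imp_has_derivative
        blinfun.bounded_linear_right)
  have "0 \<le> g (u - z) + 1 / \<gamma> * (?D z (u - z) - 0 - ?D y (u - z - 0))"
  proof (rule has_derivative_ge_along_segment[OF Q z yu(2) h])
    show "t * 0 \<le> ?h (z + t *\<^sub>R (u - z)) - ?h z" if "0 < t" "t < 1" for t
    proof -
      have "z + t *\<^sub>R (u - z) = (1 - t) *\<^sub>R z + t *\<^sub>R u"
        by (simp add: algebra_simps)
      then have "z + t *\<^sub>R (u - z) \<in> Q"
        using convexD_alt[OF Q z yu(2), of t] that by simp
      from le[OF this] show ?thesis by simp
    qed
  qed simp
  then have "0 \<le> \<gamma> * g (u - z) + (?D z (u - z) - ?D y (u - z))"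
    using \<gamma> by (simp add: field_simps)
  moreover have "?D y (u - z) = ?D y (u - y) - ?D y (z - y)"
    using linear_diff[OF lin[OF yu(1)], of "u - y" "z - y"] by simp
  moreover have "g (u - z) = - g (z - u)"
    by (simp add: blinfun.diff_right)
  ultimately show ?thesis by (simp add: bregman_def)
qed

lemma mirror_step_bound:
  fixes \<psi> f :: "'a::real_normed_vector \<Rightarrow> real" and g :: "'a \<Rightarrow>\<^sub>L real"
  assumes sc: "strongly_convex_on Q \<sigma> \<psi>" "\<sigma> > 0" and diff: "\<psi> differentiable_on Q"
    and yu: "y \<in> Q" "u \<in> Q" and \<gamma>: "\<gamma> > 0"
    and g: "g \<in> subdifferential Q f y"
    and min: "is_arg_min (\<lambda>u. g u + 1 / \<gamma> * bregman Q \<psi> u y) (\<lambda>u. u \<in> Q) z"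
  shows "f y - f u \<le> 1 / \<gamma> * (bregman Q \<psi> u y - bregman Q \<psi> u z) + \<gamma> * (norm g)\<^sup>2 / (2 * \<sigma>)"
proof -
  have Q: "convex Q" using sc by (simp add: strongly_convex_on_def)
  have z: "z \<in> Q" using min by (simp add: is_arg_min_def)
  have "\<gamma> * g (y - z) \<le> \<gamma> * (norm g * norm (z - y))"
    using norm_blinfun[of g "y - z"] \<gamma> by (auto simp: norm_minus_commute)
  also have "\<dots> \<le> \<sigma> / 2 * (norm (z - y))\<^sup>2 + \<gamma>\<^sup>2 * (norm g)\<^sup>2 / (2 * \<sigma>)"
  proof -
    \<comment> \<open>The square is weighted so that its term in \<open>norm (z - y)\<close> is
      exactly the one that \<open>bregman Q \<psi> z y\<close> dominates.\<close>
    have "0 \<le> (\<sigma> * norm (z - y) - \<gamma> * norm g)\<^sup>2 / (2 * \<sigma>)" using sc by simp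
    also have "\<dots> = \<sigma> / 2 * (norm (z - y))\<^sup>2 + \<gamma>\<^sup>2 * (norm g)\<^sup>2 / (2 * \<sigma>)
        - \<gamma> * (norm g * norm (z - y))"
      using sc by (simp add: field_simps power2_eq_square)
    finally show ?thesis by simp
  qed
  also have "\<sigma> / 2 * (norm (z - y))\<^sup>2 \<le> bregman Q \<psi> z y"
    by (rule bregman_ge_norm[OF sc(1) diff z yu(1)])
  finally have "\<gamma> * g (y - z) + \<gamma> * g (z - u)
      \<le> bregman Q \<psi> u y - bregman Q \<psi> u z + \<gamma>\<^sup>2 * (norm g)\<^sup>2 / (2 * \<sigma>)"
    using mirror_step_optimality[OF Q diff yu \<gamma> min] by simp
  \<comment> \<open>The subgradient inequality, with \<open>y - u\<close> split at
    \<open>z\<close>.\<close>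
  moreover have "f y - f u \<le> g (y - z) + g (z - u)"
  proof -
    have "f y + g (u - y) \<le> f u" using g yu by (simp add: subdifferential_def)
    then show ?thesis by (simp add: blinfun.diff_right)
  qed
  then have "\<gamma> * (f y - f u) \<le> \<gamma> * (g (y - z) + g (z - u))"
    using \<gamma> by (intro mult_left_mono) auto
  ultimately have "\<gamma> * (f y - f u)
      \<le> bregman Q \<psi> u y - bregman Q \<psi> u z + \<gamma>\<^sup>2 * (norm g)\<^sup>2 / (2 * \<sigma>)"
    by (simp add: distrib_left)
  then have "f y - f u
      \<le> (bregman Q \<psi> u y - bregman Q \<psi> u z + \<gamma>\<^sup>2 * (norm g)\<^sup>2 / (2 * \<sigma>)) / \<gamma>"
    using \<gamma> by (simp add: pos_le_divide_eq mult.commute)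
  also have "\<dots> = 1 / \<gamma> * (bregman Q \<psi> u y - bregman Q \<psi> u z) + \<gamma> * (norm g)\<^sup>2 / (2 * \<sigma>)"
    using \<gamma> sc by (simp add: field_simps power2_eq_square)
  finally show ?thesis .
qed

section \<open>Two summation estimates\<close>

text \<open>Abel summation as an induction: the remainder \<open>c n * (R - V (Suc n))\<close> stays
  in the bound and, since \<open>V (Suc n) \<le> R\<close>, only grows when the next weight replaces
  \<open>c n\<close>.\<close>

lemma sum_mono_weights_telescope_le:
  fixes c V :: "nat \<Rightarrow> real"
  assumes "n \<ge> 1" and "\<And>k. k \<in> {1..n} \<Longrightarrow> V k \<le> R"
    and "\<And>k. 1 \<le> k \<Longrightarrow> k < n \<Longrightarrow> c k \<le> c (Suc k)"
    and "c 1 \<ge> 0"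
  shows "(\<Sum>k=1..n. c k * (V k - V (Suc k))) \<le> c n * (R - V (Suc n))"
  using assms
proof (induction n rule: dec_induct)
  case base
  then show ?case by (auto intro: mult_left_mono)
next
  case (step n)
  have "c n * (R - V (Suc n)) \<le> c (Suc n) * (R - V (Suc n))"
    using step by (intro mult_right_mono) auto
  moreover have "(\<Sum>k=1..n. c k * (V k - V (Suc k))) \<le> c n * (R - V (Suc n))"
    using step by auto
  ultimately show ?case by (simp add: algebra_simps)
qed

lemma sum_inverse_sqrt_le: "(\<Sum>k=1..n. 1 / sqrt (real k)) \<le> 2 * sqrt (real n)"
proof (induction n)
  case (Suc n)
  let ?s = "sqrt (real n)" and ?r = "sqrt (real (Suc n))"
  have r: "?r > 0" by simp
  \<comment> \<open>The right side is 2n + 1, that is \<open>2 * ?r\<^sup>2 - 1\<close>; dividing by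
    \<open>?r\<close> gives a telescoping bound.\<close>
  have "2 * ?s * ?r \<le> ?s\<^sup>2 + ?r\<^sup>2"
    by (rule sum_squares_bound)
  then have "1 / ?r \<le> 2 * ?r - 2 * ?s"
    using r by (simp add: field_simps)
  with Suc show ?case by simp
qed simp

section \<open>The running maximum\<close>

text \<open>Only index 0 carries \<open>-\<infinity>\<close>, which \<open>real_of_ereal\<close>
  sends to 0; from index 1 on the maximum is finite.\<close>

lemma real_of_run_max_Suc:
  "ereal (real_of_ereal (run_max a g (Suc k))) = run_max a g (Suc k)"
  by (induction k) (auto simp: max_def)

lemma run_max_ge:
  assumes "k \<ge> 1"
  shows "norm (g k) * real k powr ((1 - a) / 2) \<le> real_of_ereal (run_max a g k)"
proof -
  obtain j where k: "k = Suc j" using assms by (cases k) auto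
  have "ereal (norm (g k) * real k powr ((1 - a) / 2)) \<le> ereal (real_of_ereal (run_max a g k))"
    unfolding k real_of_run_max_Suc by simp
  then show ?thesis by simp
qed

lemma run_max_mono:
  assumes "k \<ge> 1"
  shows "real_of_ereal (run_max a g k) \<le> real_of_ereal (run_max a g (Suc k))"
proof -
  obtain j where k: "k = Suc j" using assms by (cases k) auto
  have "run_max a g k \<le> run_max a g (Suc k)" by simp
  then have "ereal (real_of_ereal (run_max a g k)) \<le> ereal (real_of_ereal (run_max a g (Suc k)))"
    unfolding k real_of_run_max_Suc .
  then show ?thesis by simp
qed

text \<open>For \<open>a \<le> 1\<close> the exponent is nonnegative, so each candidate in the
  maximum is largest when its norm is replaced by \<open>M\<close> and its index by
  \<open>k\<close>.\<close>

lemma run_max_le: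
  assumes "k \<ge> 1" "a \<le> 1" and M: "\<And>i. i \<in> {1..k} \<Longrightarrow> norm (g i) \<le> M"
  shows "real_of_ereal (run_max a g k) \<le> M * real k powr ((1 - a) / 2)"
proof -
  obtain j where k: "k = Suc j" using assms by (cases k) auto
  have M0: "0 \<le> M" using order_trans[OF norm_ge_zero M[of k]] assms(1) by simp
  have "run_max a g j \<le> ereal (M * real k powr ((1 - a) / 2))" if "j \<le> k" for j
    using that
  proof (induction j)
    case (Suc j)
    have "norm (g (Suc j)) * real (Suc j) powr ((1 - a) / 2) \<le> M * real k powr ((1 - a) / 2)"
      using M[of "Suc j"] M0 Suc.prems assms(2) by (intro mult_mono powr_mono2) auto
    with Suc show ?case by simp
  qed simp
  from this[of k] have "ereal (real_of_ereal (run_max a g k)) \<le> ereal (M * real k powr ((1 - a) / 2))"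
    by (simp only: k real_of_run_max_Suc)
  then show ?thesis by simp
qed

section \<open>The convergence rate\<close>

theorem corollary1:
  fixes Q :: "'a::real_normed_vector set"
    and \<psi> f :: "'a \<Rightarrow> real"
    and \<sigma> R a :: real
    and N :: nat
    and x :: "nat \<Rightarrow> 'a"
    and xs :: 'a
    and g :: "nat \<Rightarrow> 'a \<Rightarrow>\<^sub>L real"
  assumes fin_dim: "\<exists>B::'a set. finite B \<and> span B = UNIV"
    and Q: "compact Q" "convex Q"
    and psi: "closed (epigraph Q \<psi>)" "\<psi> differentiable_on Q"
    and sigma: "\<sigma> > 0" "strongly_convex_on Q \<sigma> \<psi>"
    and f: "convex_on Q f" "continuous_on Q f"
    and opt: "is_arg_min f (\<lambda>u. u \<in> Q) xs"
    and R: "R > 0" "\<forall>u\<in>Q. bregman Q \<psi> xs u \<le> R"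
    and a: "a \<in> {0..1}"
    and N: "N \<ge> 1"
    and G_pos: "\<forall>k\<in>{1..N}. run_max a g k > 0"
    and md: "mirror_descent Q \<psi> f (step_size \<sigma> R a g) N g x"
  shows "f ((1 / real N) *\<^sub>R (\<Sum>k=1..N. x k)) - f xs
    \<le> 3 * sqrt (R / (2 * \<sigma>)) * (1 / sqrt (real N)) * (MAX k\<in>{1..N}. norm (g k))"
proof -
  define \<gamma> where "\<gamma> = step_size \<sigma> R a g"
  define G where "G k = real_of_ereal (run_max a g k)" for k
  define M where "M = (MAX k\<in>{1..N}. norm (g k))"
  define V where "V k = bregman Q \<psi> xs (x k)" for k
  define S where "S = sqrt (2 * \<sigma> * R)"
  have S: "S > 0" "S\<^sup>2 = 2 * \<sigma> * R" using sigma R by (auto simp: S_def)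
  have \<gamma>_eq: "\<gamma> k = S / (G k * real k powr (a / 2))" for k
    by (simp add: \<gamma>_def step_size_def G_def S_def)
  have M: "norm (g k) \<le> M" if "k \<in> {1..N}" for k
    unfolding M_def using that by (intro Max_ge) auto
  have G: "G k > 0" if kN: "k \<in> {1..N}" for k
  proof -
    obtain j where k: "k = Suc j" using kN by (cases k) auto
    have "0 < ereal (G k)"
      using G_pos kN unfolding G_def k real_of_run_max_Suc by blast
    then show ?thesis by simp
  qed
  have G_le: "G k \<le> M * real k powr ((1 - a) / 2)" if "k \<in> {1..N}" for k
    unfolding G_def using that a M by (intro run_max_le) auto
  have \<gamma>: "\<gamma> k > 0" if "k \<in> {1..N}" for k
    using G[OF that] S that by (simp add: \<gamma>_eq)
  \<comment> \<open>This is where \<open>a\<close> cancels: the exponents add up to 1/2.\<close>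
  have powr_sqrt: "real k powr ((1 - a) / 2) * real k powr (a / 2) = sqrt (real k)"
    if "k \<ge> 1" for k
    using that by (simp add: powr_add[symmetric] powr_half_sqrt[symmetric] add_divide_distrib[symmetric])
  have xs: "xs \<in> Q" using opt by (simp add: is_arg_min_def)
  have xQ: "x k \<in> Q" if kN: "k \<in> {1..Suc N}" for k
  proof (cases "k = 1")
    case True
    then show ?thesis using md by (simp add: mirror_descent_def)
  next
    case False
    with kN obtain j where "k = Suc j" "j \<in> {1..N}" by (cases k) auto
    then show ?thesis using md by (auto simp: mirror_descent_def is_arg_min_def)
  qed
  \<comment> \<open>Index \<open>Suc N\<close> is included because nonnegativity there lets the
    leftover term of the telescoped sum be dropped.\<close>
  have V: "0 \<le> V k" "V k \<le> R" if "k \<in> {1..Suc N}" for k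
  proof -
    have "0 \<le> \<sigma> / 2 * (norm (xs - x k))\<^sup>2" using sigma by simp
    also have "\<dots> \<le> V k"
      unfolding V_def by (rule bregman_ge_norm[OF sigma(2) psi(2) xs xQ[OF that]])
    finally show "0 \<le> V k" .
    show "V k \<le> R" using R(2) xQ[OF that] by (simp add: V_def)
  qed
  have step: "f (x k) - f xs \<le> 1 / \<gamma> k * (V k - V (Suc k)) + \<gamma> k * (norm (g k))\<^sup>2 / (2 * \<sigma>)"
    if k: "k \<in> {1..N}" for k
    unfolding V_def
  proof (rule mirror_step_bound[OF sigma(2,1) psi(2) _ xs \<gamma>[OF k]])
    show "x k \<in> Q" using k xQ by auto
  qed (use md k in \<open>auto simp: mirror_descent_def \<gamma>_def\<close>)
  have "(\<Sum>k=1..N. 1 / \<gamma> k * (V k - V (Suc k))) \<le> 1 / \<gamma> N * (R - V (Suc N))"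
  proof (rule sum_mono_weights_telescope_le)
    show "1 / \<gamma> k \<le> 1 / \<gamma> (Suc k)" if "1 \<le> k" "k < N" for k
    proof -
      have "G k * real k powr (a / 2) \<le> G (Suc k) * real (Suc k) powr (a / 2)"
        using that a G[of "Suc k"] run_max_mono[OF that(1), of a g]
        by (intro mult_mono powr_mono2) (auto simp: G_def)
      then show ?thesis using S by (simp add: \<gamma>_eq divide_right_mono)
    qed
    show "1 / \<gamma> 1 \<ge> 0" using \<gamma>[of 1] N by simp
  qed (use N V in auto)
  also have "\<dots> \<le> 1 / \<gamma> N * R"
    using \<gamma>[of N] V[of "Suc N"] N by (intro mult_left_mono) auto
  also have "\<dots> \<le> R * (M * sqrt (real N)) / S"
  proof -
    have "G N * real N powr (a / 2) \<le> M * real N powr ((1 - a) / 2) * real N powr (a / 2)"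
      using G_le[of N] N by (intro mult_right_mono) auto
    also have "\<dots> = M * sqrt (real N)" using powr_sqrt[OF N] by (simp add: mult.assoc)
    finally show ?thesis
      using S R by (simp add: \<gamma>_eq divide_right_mono mult.commute mult_left_mono)
  qed
  finally have sum1: "(\<Sum>k=1..N. 1 / \<gamma> k * (V k - V (Suc k))) \<le> R * (M * sqrt (real N)) / S" .
  have "\<gamma> k * (norm (g k))\<^sup>2 / (2 * \<sigma>) \<le> S * M / (2 * \<sigma>) * (1 / sqrt (real k))"
    if k: "k \<in> {1..N}" for k
  proof -
    let ?p = "real k powr ((1 - a) / 2)" and ?q = "real k powr (a / 2)"
    have pos: "G k > 0" "?p > 0" "?q > 0" using G[OF k] k by auto
    \<comment> \<open>One factor \<open>norm (g k)\<close> is at most \<open>M\<close>; the other,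
      times \<open>?p\<close>, is a candidate in the running maximum.\<close>
    have "norm (g k) * (norm (g k) * ?p) \<le> M * G k"
      using M[OF k] run_max_ge[of k g a] k order_trans[OF norm_ge_zero M[OF k]]
      by (intro mult_mono) (auto simp: G_def)
    then have "(norm (g k))\<^sup>2 / (G k * ?q) \<le> M / (?p * ?q)"
      using pos by (simp add: field_simps power2_eq_square)
    also have "?p * ?q = sqrt (real k)" using k by (intro powr_sqrt) auto
    finally have "S / (2 * \<sigma>) * ((norm (g k))\<^sup>2 / (G k * ?q)) \<le> S / (2 * \<sigma>) * (M / sqrt (real k))"
      using S sigma by (intro mult_left_mono) auto
    then show ?thesis by (simp add: \<gamma>_eq mult_ac)
  qed
  then have "(\<Sum>k=1..N. \<gamma> k * (norm (g k))\<^sup>2 / (2 * \<sigma>))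
      \<le> (\<Sum>k=1..N. S * M / (2 * \<sigma>) * (1 / sqrt (real k)))"
    by (rule sum_mono)
  also have "\<dots> = S * M / (2 * \<sigma>) * (\<Sum>k=1..N. 1 / sqrt (real k))"
    by (rule sum_distrib_left[symmetric])
  also have "\<dots> \<le> S * M / (2 * \<sigma>) * (2 * sqrt (real N))"
    using S sigma N order_trans[OF norm_ge_zero M[of N]]
    by (intro mult_left_mono sum_inverse_sqrt_le) auto
  finally have sum2: "(\<Sum>k=1..N. \<gamma> k * (norm (g k))\<^sup>2 / (2 * \<sigma>))
      \<le> S * M / (2 * \<sigma>) * (2 * sqrt (real N))" .
  define T where "T = sqrt (R / (2 * \<sigma>))"
  have RS: "R / S = T" and S\<sigma>: "S / (2 * \<sigma>) = T"
  proof -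
    have S_eq: "S = 2 * \<sigma> * T"
      unfolding S_def T_def using sigma R
      by (intro real_sqrt_unique) (auto simp: power_mult_distrib power2_eq_square)
    show "S / (2 * \<sigma>) = T" using S_eq sigma by simp
    have "R / S = R / (2 * \<sigma> * T)" using S_eq by simp
    also have "\<dots> = T\<^sup>2 / T" using sigma R by (simp add: T_def)
    also have "\<dots> = T" by (simp add: power2_eq_square)
    finally show "R / S = T" .
  qed
  have "(\<Sum>k=1..N. f (x k) - f xs)
      \<le> (\<Sum>k=1..N. 1 / \<gamma> k * (V k - V (Suc k)) + \<gamma> k * (norm (g k))\<^sup>2 / (2 * \<sigma>))"
    by (intro sum_mono step)
  \<comment> \<open>With \<open>R / S\<close> and \<open>S / (2 * \<sigma>)\<close> both equal to
    \<open>T\<close>, the constant 3 is 1 from the first sum plus 2 from the second.\<close>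
  also have "\<dots> \<le> R * (M * sqrt (real N)) / S + S * M / (2 * \<sigma>) * (2 * sqrt (real N))"
    using sum1 sum2 by (simp only: sum.distrib add_mono)
  also have "\<dots> = R / S * (M * sqrt (real N)) + S / (2 * \<sigma>) * (2 * M * sqrt (real N))"
    by simp
  also have "\<dots> = 3 * T * M * sqrt (real N)"
    unfolding RS S\<sigma> by simp
  finally have total: "(\<Sum>k=1..N. f (x k) - f xs) \<le> 3 * T * M * sqrt (real N)" .
  \<comment> \<open>Jensen's inequality with equal weights.\<close>
  have "f (\<Sum>k=1..N. (1 / real N) *\<^sub>R x k) \<le> (\<Sum>k=1..N. 1 / real N * f (x k))"
    using N xQ by (intro convex_on_sum[OF _ _ f(1)]) auto
  then have "f ((1 / real N) *\<^sub>R (\<Sum>k=1..N. x k)) - f xs \<le> 1 / real N * (\<Sum>k=1..N. f (x k)) - f xs"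
    by (simp add: scaleR_sum_right sum_distrib_left)
  also have "\<dots> = 1 / real N * (\<Sum>k=1..N. f (x k) - f xs)"
    using N by (simp add: sum_subtractf right_diff_distrib)
  also have "\<dots> \<le> 1 / real N * (3 * T * M * sqrt (real N))"
    by (intro mult_left_mono total) auto
  also have "\<dots> = 3 * T * (sqrt (real N) / real N) * M"
    by simp
  also have "sqrt (real N) / real N = 1 / sqrt (real N)"
    by (simp add: sqrt_divide_self_eq inverse_eq_divide)
  finally show ?thesis by (simp only: T_def M_def)
qed

end
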